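(* Let $x_1,x_2,\dots$ be independent and, given the unknown $h\in\mathbb R$, normally distributed with mean $h$ and variance $1$; let $H_0=\{h\le0\}$, $H_1=\{h>0\}$ and $\alpha=0.975$. Then there is no uniformly most powerful frequentist data collection and analysis plan at confidence $\alpha$: for every frequentist data collection and analysis plan $D$ at confidence $\alpha$ there exist a frequentist data collection and analysis plan $D'$ at confidence $\alpha$, some $h\in H_1$ and some integer $k\ge0$ with $p_k(D',h)>p_k(D,h)$. The same holds if all plans considered (both $D$ and $D'$) are restricted to satisfy $q_0=0$.
   Context: A frequentist data collection and analysis plan at confidence $\eta$ is a sequence of measurable functions $q_0,q_1(x_1),q_2(x_1,x_2),\dots$ with values in $[0,1]$ ($q_0$ a constant). Using independent uniform random numbers $u_0,u_1,\dots$ on $(0,1)$, independent of the data, one stops immediately after collecting $x_k$ (before collecting any data if $k=0$), if one has not stopped before, when $u_k<q_k(x_1,\dots,x_k)$; if this never happens data collection continues for ever. Whenever one stops, one concludes with frequentist confidence $\eta$ that $h\in H_1$; validity of the plan at confidence $\eta$ means that for all $h\in H_0$ the probability given $h$ of ever stopping is at most $1-\eta$. $p_k(D,h)$ denotes the probability, given $h$, that under plan $D$ one stops before the collection of $x_{k+1}$. *)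

theory Defs
  imports "HOL-Probability.Probability"
begin

text \<open>
  Observations \<open>x\<^sub>1, x\<^sub>2, \<dots>\<close> are a function on the index set \<open>{1..}\<close>. The function \<open>q k\<close> of a
  plan is evaluated at \<open>(x\<^sub>1, \<dots>, x\<^sub>k)\<close>, encoded as an element of the finite product space over
  \<open>{1..k}\<close>. For \<open>k = 0\<close> this space has the single point \<open>\<lambda>_. undefined\<close>, so \<open>q 0\<close> is a constant.
\<close>

type_synonym plan = "nat \<Rightarrow> (nat \<Rightarrow> real) \<Rightarrow> real"

definition obs_space :: "nat \<Rightarrow> (nat \<Rightarrow> real) measure" where
  "obs_space k = (\<Pi>\<^sub>M i\<in>{1..k}. borel)"

definition randomizers :: "(nat \<Rightarrow> real) measure" where
  "randomizers = (\<Pi>\<^sub>M i\<in>(UNIV :: nat set). uniform_measure lborel {0<..<1})"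

definition stops_at :: "plan \<Rightarrow> (nat \<Rightarrow> real) \<Rightarrow> (nat \<Rightarrow> real) \<Rightarrow> nat \<Rightarrow> bool" where
  "stops_at q x u k \<longleftrightarrow> u k < q k (restrict x {1..k})"

text \<open>
  \<open>P h\<close> is the joint law of the data sequence given \<open>h\<close>. One has stopped before the collection of
  \<open>x\<^sub>k\<^sub>+\<^sub>1\<close> iff the stopping criterion is met at some \<open>j \<le> k\<close>.
\<close>

definition stop_prob ::
  "('h \<Rightarrow> (nat \<Rightarrow> real) measure) \<Rightarrow> plan \<Rightarrow> nat \<Rightarrow> 'h \<Rightarrow> real" where
  "stop_prob P q k h = measure (P h \<Otimes>\<^sub>M randomizers)
     {(x, u) \<in> space (P h \<Otimes>\<^sub>M randomizers). \<exists>j\<le>k. stops_at q x u j}"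

definition ever_stop_prob ::
  "('h \<Rightarrow> (nat \<Rightarrow> real) measure) \<Rightarrow> plan \<Rightarrow> 'h \<Rightarrow> real" where
  "ever_stop_prob P q h = measure (P h \<Otimes>\<^sub>M randomizers)
     {(x, u) \<in> space (P h \<Otimes>\<^sub>M randomizers). \<exists>j. stops_at q x u j}"

definition freq_plan ::
  "('h \<Rightarrow> (nat \<Rightarrow> real) measure) \<Rightarrow> 'h set \<Rightarrow> real \<Rightarrow> plan \<Rightarrow> bool" where
  "freq_plan P H0 \<eta> q \<longleftrightarrow>
     (\<forall>k. q k \<in> borel_measurable (obs_space k)) \<and>
     (\<forall>k. \<forall>x\<in>space (obs_space k). 0 \<le> q k x \<and> q k x \<le> 1) \<and>
     (\<forall>h\<in>H0. ever_stop_prob P q h \<le> 1 - \<eta>)"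

definition normal_data :: "real \<Rightarrow> (nat \<Rightarrow> real) measure" where
  "normal_data h = (\<Pi>\<^sub>M i\<in>{1..}. density lborel (normal_density h 1))"

end

theory Submission imports Defs begin

text \<open>
  A valid plan may spend a total null probability of \<open>1 - \<alpha>\<close> on stopping, and being optimal after
  the first observation forces it to spend all of it there. Choose \<open>z\<close> such that a standard normal
  variable exceeds \<open>z\<close> with probability \<open>1 - \<alpha>\<close>, and suppose that a plan \<open>D\<close> is beaten, at
  \<open>h = 1\<close>, neither by the plan that stops after one observation iff \<open>x\<^sub>1 > z\<close>, nor by the plan that
  stops after two observations iff \<open>x\<^sub>1 + x\<^sub>2 > sqrt 2 * z\<close>.

  The first of these is the most powerful test based on \<open>x\<^sub>1\<close>. By the Neyman-Pearson inequality
  (\<open>stop_prob_one_np\<close>), \<open>D\<close> can match its power at \<open>h = 1\<close> only if it stops by time 1 with null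
  probability at least \<open>1 - \<alpha>\<close>. Validity of \<open>D\<close> at \<open>h = 0\<close> then leaves probability zero, under
  \<open>h = 0\<close>, for stopping at time 2. The laws of \<open>(x\<^sub>1, x\<^sub>2)\<close> for different \<open>h\<close> have the same null
  sets, so \<open>D\<close> does not stop at time 2 under \<open>h = 1\<close> either (\<open>stop_prob_two_eq\<close>). Hence by time 2
  it has stopped with probability at most \<open>tail (z - 1)\<close>, again by Neyman-Pearson, which is
  less than the power \<open>tail (z - sqrt 2)\<close> of the second competitor.

  Neither competitor stops before the first observation, so the same argument settles
  the unrestricted statement and the one with \<open>q\<^sub>0 = 0\<close>. Randomisation needs no separate theory of
  randomised tests: once the uniform numbers \<open>u\<close> are fixed, stopping is a deterministic region
  in the observations, and inequalities between regions are integrated over \<open>u\<close>.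
\<close>

section \<open>The Neyman-Pearson inequality and normal tails\<close>

text \<open>
  The difference of the two sides is the integral of \<open>(f - c * g) * (1\<^sub>Z - 1\<^sub>A)\<close>, whose integrand is
  pointwise nonnegative. In this additive form no subtraction in \<open>ennreal\<close> occurs, and the
  inequality can be averaged over a randomising variable on which \<open>A\<close> depends.
\<close>

lemma neyman_pearson:
  assumes [measurable]: "f \<in> borel_measurable M" "g \<in> borel_measurable M"
    "A \<in> sets M" "Z \<in> sets M"
    and inside: "\<And>x. x \<in> Z \<Longrightarrow> c * g x \<le> (f x :: ennreal)"
    and outside: "\<And>x. x \<in> space M - Z \<Longrightarrow> f x \<le> c * g x"
  shows "emeasure (density M f) A + c * emeasure (density M g) Z
       \<le> emeasure (density M f) Z + c * emeasure (density M g) A"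
proof -
  have "emeasure (density M f) A + c * emeasure (density M g) Z
      = (\<integral>\<^sup>+x. f x * indicator A x + c * (g x * indicator Z x) \<partial>M)"
    by (simp add: emeasure_density nn_integral_add nn_integral_cmult)
  also have "\<dots> \<le> (\<integral>\<^sup>+x. f x * indicator Z x + c * (g x * indicator A x) \<partial>M)"
    using inside outside
    by (intro nn_integral_mono) (auto simp: indicator_def add.commute)
  also have "\<dots> = emeasure (density M f) Z + c * emeasure (density M g) A"
    by (simp add: emeasure_density nn_integral_add nn_integral_cmult)
  finally show ?thesis .
qed

abbreviation normal :: "real \<Rightarrow> real measure" where
  "normal h \<equiv> density lborel (normal_density h 1)"

definition tail :: "real \<Rightarrow> real" where
  "tail c = measure (normal 0) {c<..}"

lemma real_distribution_normal: "real_distribution (normal h)"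
  unfolding real_distribution_def real_distribution_axioms_def
  by (simp add: prob_space_normal_density)

lemma tail_strict_antimono:
  assumes "a < b"
  shows "tail b < tail a"
proof -
  interpret real_distribution "normal 0" by (rule real_distribution_normal)
  have "measure (normal 0) {a<..b} \<noteq> 0"
  proof
    assume "measure (normal 0) {a<..b} = 0"
    then have "{a<..b} \<in> null_sets (normal 0)"
      by (simp add: null_sets_def emeasure_eq_measure)
    then have "AE x in lborel. x \<notin> {a<..b}"
      by (subst (asm) null_sets_density_iff)
         (auto simp: normal_density_pos less_imp_neq[symmetric] not_le)
    then have "emeasure lborel {a<..b} = 0"
      by (subst (asm) AE_iff_null_sets[symmetric]) (auto simp: null_sets_def)
    with assms show False by simp
  qed
  then have "0 < measure (normal 0) {a<..b}" by (simp add: zero_less_measure_iff)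
  moreover have "tail a = measure (normal 0) {a<..b} + tail b"
    unfolding tail_def using assms
    by (subst finite_measure_Union[symmetric]) (auto intro!: arg_cong[where f="measure _"])
  ultimately show ?thesis by simp
qed

lemma ex_tail_eq:
  assumes "0 < p" "p < 1"
  obtains z where "tail z = p"
proof -
  interpret real_distribution "normal 0" by (rule real_distribution_normal)
  have tail: "tail c = 1 - cdf (normal 0) c" for c
    unfolding tail_def cdf_def
    by (subst prob_compl[symmetric]) (auto intro!: arg_cong[where f="measure _"])
  have "measure (normal 0) {x} = 0" for x
    by (simp add: measure_def emeasure_density nn_integral_indicator_singleton)
  then have cont: "isCont (cdf (normal 0)) x" for x
    by (simp add: isCont_cdf)
  have "eventually (\<lambda>x. cdf (normal 0) x < 1 - p) at_bot"
    using assms by (intro order_tendstoD(2)[OF cdf_lim_at_bot]) simp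
  then obtain a where a: "cdf (normal 0) a < 1 - p"
    using eventually_happens trivial_limit_at_bot_linorder by blast
  have "eventually (\<lambda>x. cdf (normal 0) x > 1 - p) at_top"
    using assms by (intro order_tendstoD(1)[OF cdf_lim_at_top_prob]) simp
  then obtain b where b: "cdf (normal 0) b > 1 - p"
    using eventually_happens trivial_limit_at_top_linorder by blast
  have "a \<le> b" using a b cdf_nondecreasing[of b a] by linarith
  then obtain z where "cdf (normal 0) z = 1 - p"
    using IVT[of "cdf (normal 0)" a "1 - p" b] a b cont by auto
  then show thesis using that[of z] tail by simp
qed

lemma (in prob_space) normal_tail:
  assumes X: "distributed M lborel X (normal_density \<mu> \<sigma>)" and \<sigma>: "0 < \<sigma>"
  shows "prob {x\<in>space M. c < X x} = tail ((c - \<mu>) / \<sigma>)"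
proof -
  have d: "distributed M lborel (\<lambda>x. (X x - \<mu>) / \<sigma>) std_normal_density"
    using X normal_standard_normal_convert[OF \<sigma>] by simp
  then have "normal 0 = distr M lborel (\<lambda>x. (X x - \<mu>) / \<sigma>)"
    by (simp add: distributed_distr_eq_density)
  moreover have "(\<lambda>x. (X x - \<mu>) / \<sigma>) \<in> M \<rightarrow>\<^sub>M lborel"
    using d by (rule distributed_measurable)
  ultimately have "tail ((c - \<mu>) / \<sigma>)
      = prob ((\<lambda>x. (X x - \<mu>) / \<sigma>) -` {(c - \<mu>) / \<sigma> <..} \<inter> space M)"
    unfolding tail_def by (simp add: measure_distr)
  also have "(\<lambda>x. (X x - \<mu>) / \<sigma>) -` {(c - \<mu>) / \<sigma> <..} \<inter> space M = {x\<in>space M. c < X x}"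
    using \<sigma> by (auto simp: divide_strict_right_mono divide_less_cancel)
  finally show ?thesis by simp
qed

section \<open>The laws of the first two observations\<close>

lemma space_normal_data: "space (normal_data h) = ({1..} \<rightarrow>\<^sub>E UNIV)"
  by (simp add: normal_data_def space_PiM)

lemma sets_normal_data [measurable_cong]:
  "sets (normal_data h) = sets (\<Pi>\<^sub>M i\<in>{1::nat..}. (borel :: real measure))"
  unfolding normal_data_def by (intro sets_PiM_cong) auto

lemma prob_space_normal_data: "prob_space (normal_data h)"
  unfolding normal_data_def by (intro prob_space_PiM prob_space_normal_density) simp

lemma prob_space_unit_uniform: "prob_space (uniform_measure lborel {0<..<1::real})"
  by (intro prob_space_uniform_measure) auto

lemma prob_space_randomizers: "prob_space randomizers"
  unfolding randomizers_def by (intro prob_space_PiM prob_space_unit_uniform)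

lemma sets_randomizers [measurable_cong]:
  "sets randomizers = sets (\<Pi>\<^sub>M i\<in>(UNIV :: nat set). (borel :: real measure))"
  unfolding randomizers_def by (intro sets_PiM_cong) auto

lemma distr_observation:
  assumes "1 \<le> i"
  shows "distr (normal_data h) borel (\<lambda>x. x i) = normal h"
proof -
  have "distr (normal_data h) (normal h) (\<lambda>x. x i) = normal h"
    unfolding normal_data_def using assms
    by (intro distr_PiM_component prob_space_normal_density) auto
  moreover have "distr (normal_data h) borel (\<lambda>x. x i) = distr (normal_data h) (normal h) (\<lambda>x. x i)"
    by (intro distr_cong) auto
  ultimately show ?thesis by simp
qed

lemma measurable_observation [measurable]:
  "1 \<le> i \<Longrightarrow> (\<lambda>x. x i) \<in> borel_measurable (normal_data h)"
  by measurable

text \<open>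
  On a product space independence is the statement that the joint law of the coordinates is the
  product of their laws, and here the joint law is the space itself.
\<close>

lemma indep_observations:
  "prob_space.indep_vars (normal_data h) (\<lambda>_. borel) (\<lambda>i x. x i) {1..}"
proof -
  interpret prob_space "normal_data h" by (rule prob_space_normal_data)
  have "distr (normal_data h) (\<Pi>\<^sub>M i\<in>{1..}. borel) (\<lambda>x. \<lambda>i\<in>{1..}. x i)
      = distr (normal_data h) (normal_data h) (\<lambda>x. x)"
    by (intro distr_cong) (auto simp: sets_normal_data space_normal_data PiE_def extensional_restrict)
  also have "\<dots> = (\<Pi>\<^sub>M i\<in>{1..}. distr (normal_data h) borel (\<lambda>x. x i))"
    unfolding distr_id by (subst normal_data_def) (auto simp: distr_observation intro!: PiM_cong)
  finally show ?thesis
    by (subst indep_vars_iff_distr_eq_PiM') auto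
qed

lemma distr_two_observations:
  "distr (normal_data h) (borel \<Otimes>\<^sub>M borel) (\<lambda>x. (x 1, x 2)) = normal h \<Otimes>\<^sub>M normal h"
proof -
  interpret prob_space "normal_data h" by (rule prob_space_normal_data)
  have "indep_var borel (\<lambda>x. x 1) borel (\<lambda>x. x (2::nat))"
    using indep_vars_sum[of "{2}" 1 "\<lambda>i x. x i"] indep_vars_subset[OF indep_observations[of h], of "{1,2}"]
    by simp
  then show ?thesis
    by (simp add: indep_var_distribution_eq distr_observation)
qed

lemma distributed_observation:
  assumes "1 \<le> i"
  shows "distributed (normal_data h) lborel (\<lambda>x. x i) (normal_density h 1)"
proof -
  have "distr (normal_data h) lborel (\<lambda>x. x i) = distr (normal_data h) borel (\<lambda>x. x i)"
    by (intro distr_cong) auto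
  with assms show ?thesis
    by (simp add: distributed_def distr_observation)
qed

lemma distributed_sum_observations:
  "distributed (normal_data h) lborel (\<lambda>x. x 1 + x 2) (normal_density (2 * h) (sqrt 2))"
proof -
  interpret prob_space "normal_data h" by (rule prob_space_normal_data)
  have "distributed (normal_data h) lborel (\<lambda>x. \<Sum>i\<in>{1,2::nat}. x i)
      (normal_density (\<Sum>i\<in>{1,2::nat}. h) (sqrt (\<Sum>i\<in>{1,2::nat}. 1\<^sup>2)))"
    by (intro sum_indep_normal indep_vars_subset[OF indep_observations] distributed_observation) auto
  then show ?thesis by simp
qed

text \<open>
  The density of two observations with respect to Lebesgue measure is strictly positive for every
  mean, so all these laws have exactly the Lebesgue null sets.
\<close>

lemma AE_two_observations_equivalent:
  assumes "AE w in normal h \<Otimes>\<^sub>M normal h. P w"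
  shows "AE w in normal h' \<Otimes>\<^sub>M normal h'. P w"
proof -
  have dens: "normal k \<Otimes>\<^sub>M normal k
      = density (lborel \<Otimes>\<^sub>M lborel) (\<lambda>(s, t). ennreal (normal_density k 1 s) * ennreal (normal_density k 1 t))" for k
    by (intro pair_measure_density)
       (simp_all add: prob_space_normal_density prob_space_imp_sigma_finite
          lborel.sigma_finite_measure_axioms)
  show ?thesis
    using assms unfolding dens
    by (simp add: AE_density split_beta normal_density_pos ennreal_zero_less_mult_iff)
qed

section \<open>Stopping events\<close>

abbreviation joint :: "real \<Rightarrow> ((nat \<Rightarrow> real) \<times> (nat \<Rightarrow> real)) measure" where
  "joint h \<equiv> normal_data h \<Otimes>\<^sub>M randomizers"

lemma prob_space_joint: "prob_space (joint h)"
  by (intro prob_space_pair prob_space_normal_data prob_space_randomizers)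

text \<open>
  The underlying space does not depend on the mean, so one event serves all \<open>h\<close>; an index set \<open>J\<close>
  covers both stopping by time \<open>k\<close> and stopping at any time.
\<close>

definition stop_event :: "plan \<Rightarrow> nat set \<Rightarrow> ((nat \<Rightarrow> real) \<times> (nat \<Rightarrow> real)) set" where
  "stop_event q J = {(x, u) \<in> ({1..} \<rightarrow>\<^sub>E UNIV) \<times> UNIV. \<exists>j\<in>J. stops_at q x u j}"

lemma space_joint: "space (joint h) = ({1..} \<rightarrow>\<^sub>E UNIV) \<times> UNIV"
  by (simp add: space_pair_measure space_normal_data randomizers_def space_PiM)

lemma stop_prob_eq: "stop_prob normal_data q k h = measure (joint h) (stop_event q {..k})"
  unfolding stop_prob_def stop_event_def space_joint by (simp add: Bex_def)

lemma ever_stop_prob_eq: "ever_stop_prob normal_data q h = measure (joint h) (stop_event q UNIV)"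
  unfolding ever_stop_prob_def stop_event_def space_joint by simp

lemma sets_stop_event:
  assumes q: "\<And>k. q k \<in> borel_measurable (obs_space k)"
  shows "stop_event q J \<in> sets (joint h)"
proof -
  have [measurable]: "(\<lambda>x. q j (restrict x {1..j})) \<in> borel_measurable (normal_data h)" for j
    by (rule measurable_compose[OF _ q])
       (auto simp: obs_space_def measurable_cong_sets[OF sets_normal_data refl]
             intro!: measurable_restrict_subset)
  have "{w \<in> space (joint h). \<exists>j\<in>J. snd w j < q j (restrict (fst w) {1..j})} \<in> sets (joint h)"
    by measurable
  also have "{w \<in> space (joint h). \<exists>j\<in>J. snd w j < q j (restrict (fst w) {1..j})} = stop_event q J"
    unfolding stop_event_def space_joint stops_at_def by auto
  finally show ?thesis .
qed

text \<open>
  Fubini with the randomizers on the outside. If an event uses the data only through a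
  statistic \<open>X\<close>, then for fixed \<open>u\<close> it is a region \<open>B u\<close> in the range of \<open>X\<close>, and questions
  about randomised plans become questions about the law of \<open>X\<close>.
\<close>

lemma emeasure_joint_sections:
  assumes E: "E \<in> sets (joint h)" and X: "X \<in> normal_data h \<rightarrow>\<^sub>M L"
    and B: "\<And>u. B u \<in> sets L"
    and iff: "\<And>x u. x \<in> {1..} \<rightarrow>\<^sub>E UNIV \<Longrightarrow> (x, u) \<in> E \<longleftrightarrow> X x \<in> B u"
  shows "emeasure (joint h) E = (\<integral>\<^sup>+u. emeasure (distr (normal_data h) L X) (B u) \<partial>randomizers)"
    and "(\<lambda>u. emeasure (distr (normal_data h) L X) (B u)) \<in> borel_measurable randomizers"
proof -
  interpret N: prob_space "normal_data h" by (rule prob_space_normal_data)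
  interpret R: prob_space randomizers by (rule prob_space_randomizers)
  interpret pair_sigma_finite "normal_data h" randomizers ..
  have sec: "(\<lambda>x. (x, u)) -` E = X -` B u \<inter> space (normal_data h)" for u
    using sets.sets_into_space[OF E] by (auto simp: space_joint space_normal_data iff)
  have eq: "emeasure (normal_data h) ((\<lambda>x. (x, u)) -` E) = emeasure (distr (normal_data h) L X) (B u)" for u
    unfolding sec using X B by (simp add: emeasure_distr)
  show "emeasure (joint h) E = (\<integral>\<^sup>+u. emeasure (distr (normal_data h) L X) (B u) \<partial>randomizers)"
    by (simp add: emeasure_pair_measure_alt2[OF E] eq)
  show "(\<lambda>u. emeasure (distr (normal_data h) L X) (B u)) \<in> borel_measurable randomizers"
    using measurable_emeasure_Pair2[OF E] by (simp add: eq)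
qed

lemma sets_section_one:
  assumes q: "\<And>k. q k \<in> borel_measurable (obs_space k)"
  shows "{t. \<exists>j\<le>k. stops_at q (\<lambda>_. t) u j} \<in> sets borel"
proof -
  have [measurable]: "(\<lambda>t. q j (\<lambda>i\<in>{1..j}. t)) \<in> borel_measurable borel" for j
    by (rule measurable_compose[OF _ q]) (simp add: obs_space_def)
  show ?thesis unfolding stops_at_def by measurable
qed

lemma sets_section_two:
  assumes q: "\<And>k. q k \<in> borel_measurable (obs_space k)"
  shows "{w. \<exists>j\<le>k. stops_at q (\<lambda>i. if i = 1 then fst w else snd w) u j} \<in> sets (borel \<Otimes>\<^sub>M borel)"
proof -
  have [measurable]: "(\<lambda>w. q j (\<lambda>i\<in>{1..j}. if i = 1 then fst w else snd w))
      \<in> borel_measurable (borel \<Otimes>\<^sub>M borel)" for j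
    by (rule measurable_compose[OF _ q]) (simp add: obs_space_def)
  have "{w \<in> space (borel \<Otimes>\<^sub>M borel). \<exists>j\<le>k. u j < q j (\<lambda>i\<in>{1..j}. if i = 1 then fst w else snd w)}
      \<in> sets (borel \<Otimes>\<^sub>M borel)"
    by measurable
  then show ?thesis by (simp add: stops_at_def space_pair_measure)
qed

section \<open>Plans that look at the data once\<close>

definition look :: "nat \<Rightarrow> (nat \<Rightarrow> real) set \<Rightarrow> plan" where
  "look k A = (\<lambda>j x. if j = k then indicator A x else 0)"

lemma measurable_look:
  assumes "A \<in> sets (obs_space k)"
  shows "look k A j \<in> borel_measurable (obs_space j)"
  using assms by (cases "j = k") (auto simp: look_def)

lemma AE_randomizers: "AE u in randomizers. \<forall>j. 0 < u j \<and> u j < 1"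
proof -
  have "AE t in uniform_measure lborel {0<..<1::real}. 0 < t \<and> t < 1"
    by (rule AE_uniform_measureI) auto
  then have "AE u in randomizers. 0 < u j \<and> u j < 1" for j
    unfolding randomizers_def
    by (intro AE_PiM_component[where P="\<lambda>t. 0 < t \<and> t < 1"] prob_space_unit_uniform) auto
  then show ?thesis by (simp add: AE_all_countable)
qed

text \<open>
  Almost surely all randomizers lie strictly between 0 and 1, so a stopping probability of 0 never
  triggers stopping and a stopping probability of 1 always does.
\<close>

lemma prob_stop_look:
  assumes A: "A \<in> sets (obs_space k)" and "k \<in> J"
  shows "measure (joint h) (stop_event (look k A) J)
       = measure (normal_data h) {x\<in>space (normal_data h). restrict x {1..k} \<in> A}"
proof -
  interpret N: prob_space "normal_data h" by (rule prob_space_normal_data)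
  interpret R: prob_space randomizers by (rule prob_space_randomizers)
  interpret pair_prob_space "normal_data h" randomizers ..
  let ?X = "{x\<in>space (normal_data h). restrict x {1..k} \<in> A}"
  have "(\<lambda>x. restrict x {1..k}) \<in> normal_data h \<rightarrow>\<^sub>M obs_space k"
    by (auto simp: obs_space_def measurable_cong_sets[OF sets_normal_data refl]
             intro!: measurable_restrict_subset)
  from measurable_sets[OF this A] have X: "?X \<in> sets (normal_data h)"
    by (simp add: vimage_def Int_def conj_commute)
  have "AE w in joint h. \<forall>j. 0 < snd w j \<and> snd w j < 1"
    by (rule AE_pair_measure) (use AE_randomizers in auto)
  then have "AE w in joint h. w \<in> stop_event (look k A) J \<longleftrightarrow> w \<in> ?X \<times> space randomizers"
  proof (rule AE_mp, intro AE_I2 impI)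
    fix w assume w: "w \<in> space (joint h)" "\<forall>j. 0 < snd w j \<and> snd w j < 1"
    then have "stops_at (look k A) (fst w) (snd w) j \<longleftrightarrow> j = k \<and> restrict (fst w) {1..k} \<in> A" for j
      by (auto simp: stops_at_def look_def indicator_def not_less less_imp_le)
    with w \<open>k \<in> J\<close> show "w \<in> stop_event (look k A) J \<longleftrightarrow> w \<in> ?X \<times> space randomizers"
      by (auto simp: stop_event_def space_pair_measure space_normal_data randomizers_def space_PiM)
  qed
  then have "measure (joint h) (stop_event (look k A) J) = measure (joint h) (?X \<times> space randomizers)"
    using X by (intro measure_eq_AE sets_stop_event measurable_look[OF A]) auto
  also have "\<dots> = measure (normal_data h) ?X"
    using X by (simp add: measure_def R.emeasure_pair_measure_Times R.emeasure_space_1)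
  finally show ?thesis .
qed

lemma freq_plan_look:
  assumes A: "A \<in> sets (obs_space k)"
    and level: "\<And>h. h \<in> H0 \<Longrightarrow>
      measure (normal_data h) {x\<in>space (normal_data h). restrict x {1..k} \<in> A} \<le> 1 - \<eta>"
  shows "freq_plan normal_data H0 \<eta> (look k A)"
  unfolding freq_plan_def ever_stop_prob_eq
  using level measurable_look[OF A]
  by (auto simp: prob_stop_look[OF A, simplified]) (auto simp: look_def indicator_def)

definition look_first :: "real \<Rightarrow> plan" where
  "look_first z = look 1 {x\<in>space (obs_space 1). z < x 1}"

text \<open>
  The sum of two observations has standard deviation \<open>sqrt 2\<close>; the threshold is scaled so that at
  \<open>h = 0\<close> both plans stop with the same probability \<open>tail z\<close>.
\<close>

definition look_second :: "real \<Rightarrow> plan" where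
  "look_second z = look 2 {x\<in>space (obs_space 2). sqrt 2 * z < x 1 + x 2}"

lemma sets_first: "{x\<in>space (obs_space 1). z < x 1} \<in> sets (obs_space 1)"
  unfolding obs_space_def by measurable

lemma sets_second: "{x\<in>space (obs_space 2). sqrt 2 * z < x 1 + x 2} \<in> sets (obs_space 2)"
  unfolding obs_space_def by measurable

lemma prob_first:
  "measure (normal_data h) {x\<in>space (normal_data h). restrict x {1..1} \<in> {x\<in>space (obs_space 1). z < x 1}}
   = tail (z - h)"
proof -
  interpret prob_space "normal_data h" by (rule prob_space_normal_data)
  show ?thesis
    using normal_tail[OF distributed_observation[of 1 h], of z]
    by (simp add: obs_space_def space_PiM)
qed

lemma prob_second:
  "measure (normal_data h) {x\<in>space (normal_data h). restrict x {1..2} \<in> {x\<in>space (obs_space 2). sqrt 2 * z < x 1 + x 2}}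
   = tail (z - sqrt 2 * h)"
proof -
  interpret prob_space "normal_data h" by (rule prob_space_normal_data)
  have "(sqrt 2 * z - 2 * h) / sqrt 2 = z - sqrt 2 * h"
    by (simp add: field_simps)
  then show ?thesis
    using normal_tail[OF distributed_sum_observations[of h], of "sqrt 2 * z"]
    by (simp add: obs_space_def space_PiM)
qed

lemma freq_plan_first: "freq_plan normal_data {h. h \<le> 0} (1 - tail z) (look_first z)"
  unfolding look_first_def
  by (rule freq_plan_look[OF sets_first], unfold prob_first)
     (use tail_strict_antimono[of z "z - h" for h] in \<open>fastforce simp: le_less\<close>)

lemma freq_plan_second: "freq_plan normal_data {h. h \<le> 0} (1 - tail z) (look_second z)"
  unfolding look_second_def
  by (rule freq_plan_look[OF sets_second], unfold prob_second)
     (use tail_strict_antimono[of z "z - sqrt 2 * h" for h] in \<open>fastforce simp: le_less mult_less_0_iff\<close>)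

lemma stop_prob_first: "stop_prob normal_data (look_first z) 1 h = tail (z - h)"
  unfolding look_first_def stop_prob_eq
  by (subst prob_stop_look[OF sets_first]) (use prob_first in auto)

lemma stop_prob_second: "stop_prob normal_data (look_second z) 2 h = tail (z - sqrt 2 * h)"
  unfolding look_second_def stop_prob_eq
  by (subst prob_stop_look[OF sets_second]) (use prob_second in auto)

section \<open>No plan is uniformly most powerful\<close>

text \<open>
  The likelihood ratio of mean 1 against mean 0 is \<open>exp (t - 1 / 2)\<close>, increasing in \<open>t\<close>, so \<open>{z<..}\<close> is a
  likelihood ratio region. The inequality is used in two ways: a plan as powerful as this
  region at mean 1 has null probability at least \<open>tail z\<close>, and a plan with null probability
  \<open>tail z\<close> is at most as powerful.
\<close>

lemma stop_prob_one_np: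
  assumes q: "\<And>k. q k \<in> borel_measurable (obs_space k)"
  shows "\<exists>c>0. stop_prob normal_data q 1 1 + c * tail z \<le> tail (z - 1) + c * stop_prob normal_data q 1 0"
proof -
  \<comment> \<open>the likelihood ratio at the boundary of the region\<close>
  define c where "c = exp (z - 1 / 2)"
  define B where "B u = {t. \<exists>j\<le>1. stops_at q (\<lambda>_. t) u j}" for u
  interpret R: prob_space randomizers by (rule prob_space_randomizers)
  interpret J: prob_space "joint h" for h by (rule prob_space_joint)
  interpret N: real_distribution "normal h" for h by (rule real_distribution_normal)
  have B: "B u \<in> sets borel" for u
    unfolding B_def by (rule sets_section_one[OF q])
  have restr: "restrict x {1..j} = (\<lambda>i\<in>{1..j}. x 1)" if "j \<le> 1" for x :: "nat \<Rightarrow> real" and j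
  proof (rule restrict_ext)
    fix i assume "i \<in> {1..j}"
    with that have "i = 1" by simp
    then show "x i = x 1" by simp
  qed
  have stops: "stops_at q x u j \<longleftrightarrow> stops_at q (\<lambda>_. x 1) u j" if "j \<le> 1" for x u j
    unfolding stops_at_def restr[OF that, of x] ..
  have "(x, u) \<in> stop_event q {..1} \<longleftrightarrow> x 1 \<in> B u" if "x \<in> {1..} \<rightarrow>\<^sub>E UNIV" for x u
    using that stops[of _ x u] by (auto simp: stop_event_def B_def)
  note sections = emeasure_joint_sections[OF sets_stop_event[OF q] measurable_observation[of 1, OF order_refl] B this]
  have stop: "emeasure (joint h) (stop_event q {..1}) = (\<integral>\<^sup>+u. emeasure (normal h) (B u) \<partial>randomizers)"
    and [measurable]: "(\<lambda>u. emeasure (normal h) (B u)) \<in> borel_measurable randomizers" for h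
    using sections[of h] by (simp_all only: distr_observation[OF order_refl])
  have dens: "normal_density 1 1 t = exp (t - 1 / 2) * normal_density 0 1 t" for t
    by (simp add: normal_density_def exp_add[symmetric] exp_diff[symmetric] field_simps power2_eq_square)
  have "emeasure (normal 1) (B u) + ennreal c * emeasure (normal 0) {z<..}
      \<le> emeasure (normal 1) {z<..} + ennreal c * emeasure (normal 0) (B u)" for u
    using B by (intro neyman_pearson)
      (auto simp: dens c_def ennreal_mult[symmetric] intro!: ennreal_leI mult_right_mono)
  then have "(\<integral>\<^sup>+u. emeasure (normal 1) (B u) + ennreal c * emeasure (normal 0) {z<..} \<partial>randomizers)
      \<le> (\<integral>\<^sup>+u. emeasure (normal 1) {z<..} + ennreal c * emeasure (normal 0) (B u) \<partial>randomizers)"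
    by (intro nn_integral_mono)
  then have "emeasure (joint 1) (stop_event q {..1}) + ennreal c * emeasure (normal 0) {z<..}
      \<le> emeasure (normal 1) {z<..} + ennreal c * emeasure (joint 0) (stop_event q {..1})"
    by (simp add: nn_integral_add nn_integral_cmult stop[unfolded One_nat_def] R.emeasure_space_1)
  moreover have "tail (z - 1) = measure (normal 1) {z<..}"
  proof -
    have "distributed (normal 1) lborel (\<lambda>x. x) (normal_density 1 1)"
      by (simp add: distributed_def distr_id2)
    from N.normal_tail[OF this, of z] show ?thesis by (simp add: greaterThan_def)
  qed
  ultimately have "stop_prob normal_data q 1 1 + c * tail z \<le> tail (z - 1) + c * stop_prob normal_data q 1 0"
    unfolding stop_prob_eq tail_def[of z]
    by (simp add: J.emeasure_eq_measure N.emeasure_eq_measure c_def ennreal_mult[symmetric] ennreal_plus[symmetric] del: ennreal_plus)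
  then show ?thesis
    by (intro exI[of _ c]) (simp add: c_def)
qed

text \<open>
  Stopping exactly at time 2 is, for fixed randomizers, a region in \<open>(x\<^sub>1, x\<^sub>2)\<close>; if it is null for
  one mean, it is null for all of them.
\<close>

lemma stop_prob_two_eq:
  assumes q: "\<And>k. q k \<in> borel_measurable (obs_space k)"
    and eq: "stop_prob normal_data q 2 h = stop_prob normal_data q 1 h"
  shows "stop_prob normal_data q 2 h' = stop_prob normal_data q 1 h'"
proof -
  define S where "S k u = {w. \<exists>j\<le>k. stops_at q (\<lambda>i. if i = 1 then fst w else snd w) u j}" for k :: nat and u
  define B where "B u = S 2 u - S 1 u" for u
  define E where "E = stop_event q {..2} - stop_event q {..1}"
  interpret R: prob_space randomizers by (rule prob_space_randomizers)
  interpret J: prob_space "joint m" for m by (rule prob_space_joint)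
  have sets: "stop_event q J \<in> sets (joint k)" for J k
    by (rule sets_stop_event[OF q])
  have E: "E \<in> sets (joint k)" for k
    unfolding E_def using sets by auto
  have B: "B u \<in> sets (borel \<Otimes>\<^sub>M borel)" for u
    unfolding B_def S_def using sets_section_two[OF q] by auto
  have restr: "restrict x {1..j} = (\<lambda>i\<in>{1..j}. if i = 1 then x 1 else x 2)"
    if "j \<le> 2" for x :: "nat \<Rightarrow> real" and j
  proof (rule restrict_ext)
    fix i assume "i \<in> {1..j}"
    with that have "i = 1 \<or> i = 2" by auto
    then show "x i = (if i = 1 then x 1 else x 2)" by auto
  qed
  have stops: "stops_at q x u j \<longleftrightarrow> stops_at q (\<lambda>i. if i = 1 then x 1 else x 2) u j"
    if "j \<le> 2" for x u j
    unfolding stops_at_def restr[OF that, of x] ..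
  have "(\<exists>j\<le>k. stops_at q x u j) \<longleftrightarrow> (x 1, x 2) \<in> S k u" if "k \<le> 2" for x u k
    using that stops[of _ x u] order_trans[OF _ that] unfolding S_def mem_Collect_eq fst_conv snd_conv
    by blast
  note by_time = this[of 1] this[of 2]
  have in_E: "(x, u) \<in> E \<longleftrightarrow> (x 1, x 2) \<in> B u" if "x \<in> {1..} \<rightarrow>\<^sub>E UNIV" for x u
    using that by_time by (simp add: E_def stop_event_def B_def Bex_def)
  have pair: "(\<lambda>x. (x 1, x 2)) \<in> normal_data k \<rightarrow>\<^sub>M borel \<Otimes>\<^sub>M borel" for k
    by (intro measurable_Pair measurable_observation) auto
  have stop: "emeasure (joint k) E = (\<integral>\<^sup>+u. emeasure (normal k \<Otimes>\<^sub>M normal k) (B u) \<partial>randomizers)"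
    and [measurable]: "(\<lambda>u. emeasure (normal k \<Otimes>\<^sub>M normal k) (B u)) \<in> borel_measurable randomizers" for k
    using emeasure_joint_sections[OF E pair B in_E, of k] by (simp_all only: distr_two_observations)
  have diff: "measure (joint k) E = stop_prob normal_data q 2 k - stop_prob normal_data q 1 k" for k
    unfolding E_def stop_prob_eq
    by (intro J.finite_measure_Diff sets) (auto simp: stop_event_def)
  have "emeasure (joint h) E = 0"
    unfolding J.emeasure_eq_measure diff eq by simp
  then have "AE u in randomizers. emeasure (normal h \<Otimes>\<^sub>M normal h) (B u) = 0"
    by (simp add: stop nn_integral_0_iff_AE)
  moreover have "emeasure (normal h' \<Otimes>\<^sub>M normal h') (B u) = 0"
    if "emeasure (normal h \<Otimes>\<^sub>M normal h) (B u) = 0" for u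
  proof -
    have Bs: "B u \<in> sets (normal k \<Otimes>\<^sub>M normal k)" for k
      using B by (simp cong: sets_pair_measure_cong)
    from that Bs have "AE w in normal h \<Otimes>\<^sub>M normal h. w \<notin> B u"
      by (subst AE_iff_null_sets[symmetric]) (auto simp: null_sets_def)
    then have "AE w in normal h' \<Otimes>\<^sub>M normal h'. w \<notin> B u"
      by (rule AE_two_observations_equivalent)
    with Bs show ?thesis
      by (subst (asm) AE_iff_null_sets[symmetric]) (auto simp: null_sets_def)
  qed
  ultimately have "AE u in randomizers. emeasure (normal h' \<Otimes>\<^sub>M normal h') (B u) = 0"
    by auto
  then have "emeasure (joint h') E = 0"
    by (simp add: stop nn_integral_0_iff_AE)
  then have "measure (joint h') E = 0"
    by (simp add: measure_def)
  with diff[of h'] show ?thesis by simp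
qed

text \<open>
  No plan can match both competitors: matching the first one exhausts the null
  probability by time 1, and this makes it impossible to gain anything from \<open>x\<^sub>2\<close>.
\<close>

lemma beaten_by_one_look:
  assumes D: "freq_plan normal_data {h. h \<le> 0} (1 - tail z) D"
  shows "stop_prob normal_data D 1 1 < stop_prob normal_data (look_first z) 1 1
       \<or> stop_prob normal_data D 2 1 < stop_prob normal_data (look_second z) 2 1"
proof (rule ccontr)
  assume "\<not> ?thesis"
  then have one: "tail (z - 1) \<le> stop_prob normal_data D 1 1"
    and two: "tail (z - sqrt 2) \<le> stop_prob normal_data D 2 1"
    unfolding stop_prob_first stop_prob_second by auto
  interpret J: prob_space "joint 0" by (rule prob_space_joint)
  have q: "\<And>k. D k \<in> borel_measurable (obs_space k)"
    and ever: "ever_stop_prob normal_data D 0 \<le> tail z"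
    using D by (auto simp: freq_plan_def)
  obtain c where "0 < c" and np: "stop_prob normal_data D 1 1 + c * tail z
      \<le> tail (z - 1) + c * stop_prob normal_data D 1 0"
    using stop_prob_one_np[OF q] by blast
  have "c * tail z \<le> c * stop_prob normal_data D 1 0"
    using np one by linarith
  with \<open>0 < c\<close> have "tail z \<le> stop_prob normal_data D 1 0" by simp
  moreover have "stop_prob normal_data D 1 0 \<le> stop_prob normal_data D 2 0"
    and "stop_prob normal_data D 2 0 \<le> ever_stop_prob normal_data D 0"
    unfolding stop_prob_eq ever_stop_prob_eq
    by (intro J.finite_measure_mono sets_stop_event[OF q]; force simp: stop_event_def)+
  ultimately have null: "stop_prob normal_data D 1 0 = tail z"
    "stop_prob normal_data D 2 0 = stop_prob normal_data D 1 0"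
    using ever by linarith+
  have "stop_prob normal_data D 2 1 = stop_prob normal_data D 1 1"
    using q null(2) by (rule stop_prob_two_eq)
  also have "\<dots> \<le> tail (z - 1)"
    using np null(1) by simp
  also have "\<dots> < tail (z - sqrt 2)"
    by (intro tail_strict_antimono) simp
  finally show False using two by simp
qed

theorem mainTheorem4:
  fixes H0 H1 :: "real set" and \<alpha> :: real
  defines "H0 \<equiv> {h. h \<le> 0}" and "H1 \<equiv> {h. h > 0}" and "\<alpha> \<equiv> 0.975"
  shows "(\<forall>D. freq_plan normal_data H0 \<alpha> D \<longrightarrow>
            (\<exists>D' h k. freq_plan normal_data H0 \<alpha> D' \<and> h \<in> H1 \<and>
               stop_prob normal_data D' k h > stop_prob normal_data D k h)) \<and>
         (\<forall>D. freq_plan normal_data H0 \<alpha> D \<and> (\<forall>x\<in>space (obs_space 0). D 0 x = 0) \<longrightarrow>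
            (\<exists>D' h k. freq_plan normal_data H0 \<alpha> D' \<and> (\<forall>x\<in>space (obs_space 0). D' 0 x = 0) \<and>
               h \<in> H1 \<and> stop_prob normal_data D' k h > stop_prob normal_data D k h))"
proof -
  obtain z where "tail z = 1 - \<alpha>"
    using ex_tail_eq[of "1 - \<alpha>"] unfolding \<alpha>_def by auto
  then have \<alpha>: "\<alpha> = 1 - tail z" by simp
  have "\<exists>D' h k. freq_plan normal_data H0 \<alpha> D' \<and> (\<forall>x\<in>space (obs_space 0). D' 0 x = 0) \<and>
      h \<in> H1 \<and> stop_prob normal_data D' k h > stop_prob normal_data D k h"
    if "freq_plan normal_data H0 \<alpha> D" for D
  proof -
    have "look_first z 0 x = 0" "look_second z 0 x = 0" for x
      by (simp_all add: look_first_def look_second_def look_def)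
    moreover have "(1::real) \<in> H1" by (simp add: H1_def)
    ultimately show ?thesis
      using beaten_by_one_look that freq_plan_first[of z] freq_plan_second[of z]
      unfolding \<alpha> H0_def by meson
  qed
  then show ?thesis by meson
qed

end
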